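(* Let $f:[0,1]\to[0,1]$. Let $(x_n)_{n\in\mathbb{N}}$ be a sequence in $[0,1]$ such that for each $n$, $x_{n+1}$ is between $x_n$ and $f(x_n)$. Let $\omega:(0,\infty)\to(0,\infty)$ be a modulus of uniform continuity for $f$ and let $\beta:(0,\infty)\to\mathbb{N}$ be such that $(x_n-x_{n+1})$ tends towards $0$ with rate of convergence $\beta$. Let $\varepsilon>0$ and $g:\mathbb{N}\to\mathbb{N}$. Define \begin{align*} m&:=\left\lceil\frac{6}{\varepsilon}\right\rceil,\qquad c:=\frac{1}{4m},\\ A(p)&:=\frac{1}{\max(1,12\,m\,g(p))}\quad(p\in\mathbb{N}),\\ C(p)&:=\min\bigl(A(p),\omega(A(p))\bigr)\quad(p\in\mathbb{N}),\\ u_0&:=\beta(c),\\ u_{n+1}&:=\max\bigl(u_n+g(u_n)+1,\ \beta(C(u_n))\bigr)\quad(n\in\mathbb{N}),\\ \Phi^{\mathrm{KM}}_{\omega,\beta}(\varepsilon,g)&:=u_{2m^2}. \end{align*} Then there is an $N\in\mathbb{N}$ with $N\leq\Phi^{\mathrm{KM}}_{\omega,\beta}(\varepsilon,g)$ such that for all $i,j\in[N,N+g(N)]$, $|x_i-x_j|\leq\varepsilon$.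
   Context: $\mathbb{N}$ contains $0$. For a real number $r$, $\lceil r\rceil$ is the least integer $\geq r$. "$z$ is between $a$ and $b$" means $\min(a,b)\leq z\leq\max(a,b)$. For $N,M\in\mathbb{N}$, indices $i,j\in[N,M]$ are natural numbers with $N\leq i,j\leq M$. A modulus of uniform continuity for $f:[0,1]\to[0,1]$ is a function $\omega:(0,\infty)\to(0,\infty)$ such that for any $\delta>0$ and any $x,y\in[0,1]$ with $|x-y|<\omega(\delta)$, we have $|f(x)-f(y)|<\delta$. A real sequence $(a_n)$ tends towards $l\in\mathbb{R}$ with rate of convergence $\beta:(0,\infty)\to\mathbb{N}$ if for all $\delta>0$ and all $n\geq\beta(\delta)$, we have $|a_n-l|\leq\delta$. *)

theory Defs
  imports "HOL-Analysis.Analysis"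
begin

text \<open>Maps with domain $[0,1]$ or $(0,\infty)$ are total functions on the reals; every condition
  below constrains them, and every quantity below evaluates them, only on their intended domain.\<close>

definition lies_between :: "real \<Rightarrow> real \<Rightarrow> real \<Rightarrow> bool" where
  "lies_between z a b \<longleftrightarrow> min a b \<le> z \<and> z \<le> max a b"

definition modulus_of_uniform_continuity :: "(real \<Rightarrow> real) \<Rightarrow> (real \<Rightarrow> real) \<Rightarrow> bool" where
  "modulus_of_uniform_continuity \<omega> f \<longleftrightarrow>
     \<omega> \<in> {0<..} \<rightarrow> {0<..} \<and>
     (\<forall>\<delta>>0. \<forall>x\<in>{0..1}. \<forall>y\<in>{0..1}. \<bar>x - y\<bar> < \<omega> \<delta> \<longrightarrow> \<bar>f x - f y\<bar> < \<delta>)"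

definition tends_with_rate :: "(nat \<Rightarrow> real) \<Rightarrow> real \<Rightarrow> (real \<Rightarrow> nat) \<Rightarrow> bool" where
  "tends_with_rate a l \<beta> \<longleftrightarrow> (\<forall>\<delta>>0. \<forall>n\<ge>\<beta> \<delta>. \<bar>a n - l\<bar> \<le> \<delta>)"

text \<open>The case of interest is $\varepsilon > 0$, where the ceiling is at least 1 and the
  conversion to a natural number loses nothing.\<close>

definition KM_m :: "real \<Rightarrow> nat" where
  "KM_m \<epsilon> = nat \<lceil>6 / \<epsilon>\<rceil>"

definition KM_c :: "real \<Rightarrow> real" where
  "KM_c \<epsilon> = 1 / (4 * real (KM_m \<epsilon>))"

definition KM_A :: "real \<Rightarrow> (nat \<Rightarrow> nat) \<Rightarrow> nat \<Rightarrow> real" where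
  "KM_A \<epsilon> g p = 1 / max 1 (12 * real (KM_m \<epsilon>) * real (g p))"

definition KM_C :: "(real \<Rightarrow> real) \<Rightarrow> real \<Rightarrow> (nat \<Rightarrow> nat) \<Rightarrow> nat \<Rightarrow> real" where
  "KM_C \<omega> \<epsilon> g p = min (KM_A \<epsilon> g p) (\<omega> (KM_A \<epsilon> g p))"

primrec KM_u ::
  "(real \<Rightarrow> real) \<Rightarrow> (real \<Rightarrow> nat) \<Rightarrow> real \<Rightarrow> (nat \<Rightarrow> nat) \<Rightarrow> nat \<Rightarrow> nat" where
  "KM_u \<omega> \<beta> \<epsilon> g 0 = \<beta> (KM_c \<epsilon>)"
| "KM_u \<omega> \<beta> \<epsilon> g (Suc n) =
     max (KM_u \<omega> \<beta> \<epsilon> g n + g (KM_u \<omega> \<beta> \<epsilon> g n) + 1)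
         (\<beta> (KM_C \<omega> \<epsilon> g (KM_u \<omega> \<beta> \<epsilon> g n)))"

definition KM_Phi ::
  "(real \<Rightarrow> real) \<Rightarrow> (real \<Rightarrow> nat) \<Rightarrow> real \<Rightarrow> (nat \<Rightarrow> nat) \<Rightarrow> nat" where
  "KM_Phi \<omega> \<beta> \<epsilon> g = KM_u \<omega> \<beta> \<epsilon> g (2 * (KM_m \<epsilon>)\<^sup>2)"

end

theory Submission
  imports Defs
begin

text \<open>
  Cut $[0,1]$ into $m$ cells of length $1/m$, and call $[u_n, u_n + g(u_n)]$ the $n$-th window. If
  $x$ oscillates by more than $\varepsilon \ge 6/m$ in a window, then it crosses some
  cell completely in that window. The point of the proof is that a given cell is crossed in at most
  two windows.

  Suppose that $x$ crosses the cell $[a,b]$ upwards in the window that starts at $p$. The steps of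
  $x$ are at most $1/(4m)$ there, and there are at most $g(p)$ of them, so one of them starts at a
  point $z$ with $a < z < b$ and has length more than $2A(p)$ (lemma \<open>steep_step_in_crossing\<close>). Since
  the step goes from $z$ towards $f(z)$, it follows that $f(z) > z + 2A(p)$, and by uniform
  continuity $f(y) > y$ at all $y$ with $z \le y < z + C(p)$. Once the steps of $x$ are at most
  $C(p)$, that is, from the next window on, $x$ therefore cannot go from $[z,1]$ to
  $[0,z)$ (lemma \<open>upward_crossing_barrier\<close>). If the cell is crossed in a second window, then
  $x$ reaches $b > z$ there and never returns to $a < z$, so there is no third. Downward
  crossings are the mirror image (lemma \<open>no_third_crossing\<close>).

  If $x$ oscillated too much in each of the $2m^2+1$ windows, then, as $2m^2 + 1 > 2m$, some cell
  would be crossed in three of them.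
\<close>

text \<open>If all the steps that start in $(a,b)$ had length at most $d$, then the sequence would not get
  past $a + c + (j-i)d$: the overshoot when it enters the interval is at most $c$.\<close>

lemma steep_step_in_crossing:
  fixes x :: "nat \<Rightarrow> real"
  assumes "i \<le> j" "x i \<le> a" "b \<le> x j" "0 \<le> c" "0 \<le> d"
    and step: "\<And>k. i \<le> k \<Longrightarrow> k < j \<Longrightarrow> x (Suc k) - x k \<le> c"
    and short: "a + c + real (j - i) * d < b"
  obtains k where "i \<le> k" "k < j" "a < x k" "x k < b" "x (Suc k) - x k > d"
proof (rule ccontr)
  assume "\<not> thesis"
  with that have slow: "x (Suc k) - x k \<le> d" if "i \<le> k" "k < j" "a < x k" "x k < b" for k
    using that by (meson not_le)
  have "x (i + t) \<le> a + c + real t * d" if "t \<le> j - i" for t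
    using that
  proof (induction t)
    case 0
    then show ?case using assms by simp
  next
    case (Suc t)
    have k: "i \<le> i + t" "i + t < j" using Suc.prems by auto
    have IH: "x (i + t) \<le> a + c + real t * d" using Suc by simp
    have "0 \<le> real t * d" using \<open>0 \<le> d\<close> by simp
    have "real t * d \<le> real (j - i) * d"
      using Suc.prems \<open>0 \<le> d\<close> by (intro mult_right_mono) auto
    then have "x (i + t) < b" using IH short by linarith
    then have "x (Suc (i + t)) \<le> a + c + real t * d + d"
      using IH step[OF k] slow[OF k] \<open>0 \<le> d\<close> \<open>0 \<le> real t * d\<close>
      by (cases "x (i + t) \<le> a") linarith+
    then show ?case by (simp add: algebra_simps)
  qed
  from this[of "j - i"] show False using assms by simp
qed

text \<open>Here $y_k$ plays the role of $f(x_k)$, so that uniform continuity is required only between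
  terms of the sequence. This makes the hypotheses invariant under changing the signs of $x$ and
  $y$.\<close>

lemma upward_crossing_barrier:
  fixes x y :: "nat \<Rightarrow> real"
  assumes between: "\<And>k. lies_between (x (Suc k)) (x k) (y k)"
    and cont: "\<And>k l. \<bar>x k - x l\<bar> < w \<Longrightarrow> \<bar>y k - y l\<bar> < A"
    and "0 < A" "0 \<le> c" "i \<le> j" "x i \<le> a" "b \<le> x j"
    and step: "\<And>k. i \<le> k \<Longrightarrow> \<bar>x k - x (Suc k)\<bar> \<le> c"
    and short: "a + c + real (j - i) * (2 * A) < b"
    and late_step: "\<And>k. q \<le> k \<Longrightarrow> \<bar>x k - x (Suc k)\<bar> \<le> min A w"
  obtains z where "a < z" "z < b" "\<And>k l. q \<le> k \<Longrightarrow> k \<le> l \<Longrightarrow> z \<le> x k \<Longrightarrow> z \<le> x l"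
proof -
  have "x (Suc k) - x k \<le> c" if "i \<le> k" for k using step[OF that] by linarith
  then obtain s where s: "a < x s" "x s < b" "x (Suc s) - x s > 2 * A"
    using steep_step_in_crossing[of i j x a b c "2 * A"] \<open>0 < A\<close> \<open>0 \<le> c\<close> \<open>i \<le> j\<close> \<open>x i \<le> a\<close>
      \<open>b \<le> x j\<close> short by (metis less_imp_le mult_nonneg_nonneg zero_le_numeral)
  have steep: "y s > x s + 2 * A"
    using between[of s] s \<open>0 < A\<close> by (auto simp: lies_between_def max_def split: if_splits)
  have "x s \<le> x l" if "q \<le> k" "k \<le> l" "x s \<le> x k" for k l
    using \<open>k \<le> l\<close>
  proof (induction l rule: dec_induct)
    case base
    show ?case by fact
  next
    case (step n)
    show ?case
    proof (rule ccontr)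
      assume below: "\<not> x s \<le> x (Suc n)"
      have small: "\<bar>x n - x (Suc n)\<bar> \<le> min A w"
        using late_step[of n] step.hyps \<open>q \<le> k\<close> by simp
      \<comment> \<open>A step from above $x_s$ to below it starts within $\min(A,w)$ of $x_s$, where $y$ still points
        upwards.\<close>
      have "\<bar>x s - x n\<bar> < w" using small below step.IH by linarith
      then have "y n > y s - A" using cont[of s n] by linarith
      then have "y n > x n" using steep small below by linarith
      then show False using between[of n] below step.IH by (simp add: lies_between_def)
    qed
  qed
  then show thesis using that s by blast
qed

text \<open>The first crossing takes place within $L$ steps from time $p$; the second and third, in this
  order, take place after time $q$. Only the direction of the first matters: of the later ones it is
  used that they visit both sides of the barrier. If the first crossing is downward, the barrier
  lemma is applied to $-x$ and $-y$.\<close>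

lemma no_third_crossing:
  fixes x y :: "nat \<Rightarrow> real"
  assumes between: "\<And>k. lies_between (x (Suc k)) (x k) (y k)"
    and cont: "\<And>k l. \<bar>x k - x l\<bar> < w \<Longrightarrow> \<bar>y k - y l\<bar> < A"
    and "0 < A" "0 \<le> c"
    and step: "\<And>k. p \<le> k \<Longrightarrow> \<bar>x k - x (Suc k)\<bar> \<le> c"
    and late_step: "\<And>k. q \<le> k \<Longrightarrow> \<bar>x k - x (Suc k)\<bar> \<le> min A w"
    and short: "a + c + real L * (2 * A) < b"
    and first: "i1 \<in> {p..p + L}" "j1 \<in> {p..p + L}" "x i1 \<le> a" "b \<le> x j1"
    and second: "q \<le> i2" "q \<le> j2" "x i2 \<le> a" "b \<le> x j2"
    and third: "i2 \<le> i3" "i2 \<le> j3" "j2 \<le> i3" "j2 \<le> j3" "x i3 \<le> a" "b \<le> x j3"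
  shows False
proof (cases "i1 \<le> j1")
  case True
  have "real (j1 - i1) * (2 * A) \<le> real L * (2 * A)"
    using first \<open>0 < A\<close> by (intro mult_right_mono) auto
  then have "a + c + real (j1 - i1) * (2 * A) < b" using short by linarith
  with True obtain z where "a < z" "z < b"
    "\<And>k l. q \<le> k \<Longrightarrow> k \<le> l \<Longrightarrow> z \<le> x k \<Longrightarrow> z \<le> x l"
    using upward_crossing_barrier[of x y w A c i1 j1 a b q] assms by auto
  from this(1,2) this(3)[of j2 i3] show False using second third by linarith
next
  case False
  have "real (i1 - j1) * (2 * A) \<le> real L * (2 * A)"
    using first \<open>0 < A\<close> by (intro mult_right_mono) auto
  then have short': "- b + c + real (i1 - j1) * (2 * A) < - a" using short by linarith
  have between': "lies_between (- x (Suc k)) (- x k) (- y k)" for k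
    using between[of k] by (auto simp: lies_between_def)
  have cont': "\<bar>- y k - - y l\<bar> < A" if "\<bar>- x k - - x l\<bar> < w" for k l
    using cont[of k l] that by linarith
  have step': "\<bar>- x k - - x (Suc k)\<bar> \<le> c" if "j1 \<le> k" for k
    using step[of k] that first by auto
  have late_step': "\<bar>- x k - - x (Suc k)\<bar> \<le> min A w" if "q \<le> k" for k
    using late_step[of k] that by linarith
  have ends: "j1 \<le> i1" "- x j1 \<le> - b" "- a \<le> - x i1" using False first by auto
  obtain z where "- b < z" "z < - a"
    "\<And>k l. q \<le> k \<Longrightarrow> k \<le> l \<Longrightarrow> z \<le> - x k \<Longrightarrow> z \<le> - x l"
    using upward_crossing_barrier[of "\<lambda>k. - x k" "\<lambda>k. - y k" w A c j1 i1 "- b" "- a" q,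
      OF between' cont' \<open>0 < A\<close> \<open>0 \<le> c\<close> ends step' short' late_step'] by blast
  from this(1,2) this(3)[of i2 j3] show False using second third by linarith
qed

text \<open>The cell in question starts at the least multiple of $1/m$ that is at least $s$.\<close>

lemma interval_contains_cell:
  fixes s t :: real
  assumes "0 \<le> s" "t \<le> 1" "0 < m" "t - s > 6 / real m"
  obtains k where "k < m" "s \<le> real k / real m" "real (Suc k) / real m \<le> t"
proof
  define k where "k = nat \<lceil>real m * s\<rceil>"
  have k: "real m * s \<le> real k" "real k < real m * s + 1"
    unfolding k_def using assms ceiling_correct[of "real m * s"] by auto
  have "6 < real m * t - real m * s" using assms by (simp add: field_simps)
  then have *: "real (Suc k) \<le> real m * t" using k by simp
  moreover have "real m * t \<le> real m" using assms by (simp add: mult_left_le)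
  ultimately show "k < m" by linarith
  show "s \<le> real k / real m" using k assms by (simp add: field_simps)
  show "real (Suc k) / real m \<le> t" using * assms by (simp add: field_simps)
qed

lemma pigeonhole_three:
  fixes h :: "nat \<Rightarrow> nat"
  assumes "\<And>n. n \<le> 2 * m \<Longrightarrow> h n < m"
  obtains n1 n2 n3 where "n1 < n2" "n2 < n3" "n3 \<le> 2 * m" "h n1 = h n2" "h n2 = h n3"
proof -
  have "\<exists>k<m. card {n. n \<le> 2 * m \<and> h n = k} \<ge> 3"
  proof (rule ccontr)
    assume "\<not> ?thesis"
    then have le: "card {n. n \<le> 2 * m \<and> h n = k} \<le> 2" if "k < m" for k using that by force
    have "{..2 * m} = (\<Union>k<m. {n. n \<le> 2 * m \<and> h n = k})" using assms by auto
    then have "2 * m + 1 \<le> (\<Sum>k<m. card {n. n \<le> 2 * m \<and> h n = k})"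
      using card_UN_le[of "{..<m}" "\<lambda>k. {n. n \<le> 2 * m \<and> h n = k}"]
      by (metis Suc_eq_plus1 card_atMost finite_lessThan)
    also have "\<dots> \<le> (\<Sum>k<m. 2)" using le by (intro sum_mono) auto
    finally show False by simp
  qed
  then obtain k where "3 \<le> card {n. n \<le> 2 * m \<and> h n = k}" by blast
  then obtain T where T: "T \<subseteq> {n. n \<le> 2 * m \<and> h n = k}" "card T = 3"
    by (meson obtain_subset_with_card_n)
  then obtain p q r where "T = {p, q, r}" "p \<noteq> q" "q \<noteq> r" "p \<noteq> r"
    by (auto simp: card_3_iff)
  with T(1) show thesis
    using that[of p q r] that[of p r q] that[of q p r] that[of q r p] that[of r p q] that[of r q p]
    by simp (metis linorder_neqE_nat)
qed

lemma KM_u_less: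
  assumes "n < n'"
  shows "KM_u \<omega> \<beta> \<epsilon> g n + g (KM_u \<omega> \<beta> \<epsilon> g n) < KM_u \<omega> \<beta> \<epsilon> g n'"
  using assms
proof (induction n' rule: less_Suc_induct)
  case (1 i)
  show ?case by simp
next
  case (2 i j k)
  then show ?case by linarith
qed

theorem theorem3p1:
  fixes f :: "real \<Rightarrow> real" and x :: "nat \<Rightarrow> real"
    and \<omega> :: "real \<Rightarrow> real" and \<beta> :: "real \<Rightarrow> nat"
    and \<epsilon> :: real and g :: "nat \<Rightarrow> nat"
  assumes "f \<in> {0..1} \<rightarrow> {0..1}"
    and "\<And>n. x n \<in> {0..1}"
    and "\<And>n. lies_between (x (Suc n)) (x n) (f (x n))"
    and "modulus_of_uniform_continuity \<omega> f"
    and "tends_with_rate (\<lambda>n. x n - x (Suc n)) 0 \<beta>"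
    and "\<epsilon> > 0"
  shows "\<exists>N \<le> KM_Phi \<omega> \<beta> \<epsilon> g. \<forall>i\<in>{N..N + g N}. \<forall>j\<in>{N..N + g N}. \<bar>x i - x j\<bar> \<le> \<epsilon>"
proof (rule ccontr)
  assume unstable: "\<not> ?thesis"
  define m where "m = KM_m \<epsilon>"
  define c where "c = KM_c \<epsilon>"
  define u where "u = KM_u \<omega> \<beta> \<epsilon> g"
  have m: "0 < m" "6 / real m \<le> \<epsilon>"
  proof -
    have "0 < 6 / \<epsilon>" using \<open>\<epsilon> > 0\<close> by simp
    then show "0 < m" by (simp add: m_def KM_m_def)
    have "6 / \<epsilon> \<le> real m" unfolding m_def KM_m_def by (simp add: real_nat_ceiling_ge)
    then show "6 / real m \<le> \<epsilon>" using \<open>\<epsilon> > 0\<close> \<open>0 < m\<close> by (simp add: field_simps)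
  qed
  have c: "c = 1 / (4 * real m)" "0 < c" using m by (auto simp: c_def KM_c_def m_def)
  have rate: "\<bar>x k - x (Suc k)\<bar> \<le> \<delta>" if "\<delta> > 0" "\<beta> \<delta> \<le> k" for k \<delta>
    using assms(5) that by (auto simp: tends_with_rate_def)
  have gap: "u n + g (u n) < u n'" if "n < n'" for n n'
    unfolding u_def by (rule KM_u_less[OF that])
  have crossing: "\<exists>k<m. \<exists>i\<in>{u n..u n + g (u n)}. \<exists>j\<in>{u n..u n + g (u n)}.
      x i \<le> real k / real m \<and> real (Suc k) / real m \<le> x j" if "n \<le> 2 * m" for n
  proof -
    have "2 * m \<le> 2 * m\<^sup>2" by (simp add: power2_eq_square)
    with that have "n \<le> 2 * m\<^sup>2" by linarith
    then have "u n \<le> KM_Phi \<omega> \<beta> \<epsilon> g"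
      using gap[of n "2 * m\<^sup>2"] by (cases "n = 2 * m\<^sup>2") (auto simp: KM_Phi_def u_def m_def)
    then obtain i j where ij: "i \<in> {u n..u n + g (u n)}" "j \<in> {u n..u n + g (u n)}"
      "\<bar>x i - x j\<bar> > \<epsilon>"
      using unstable by (meson not_le)
    have "\<exists>i\<in>{u n..u n + g (u n)}. \<exists>j\<in>{u n..u n + g (u n)}. x j - x i > 6 / real m"
    proof (cases "x i \<le> x j")
      case True
      then show ?thesis using ij m by (intro bexI[of _ i] bexI[of _ j]) auto
    next
      case False
      then show ?thesis using ij m by (intro bexI[of _ j] bexI[of _ i]) auto
    qed
    then obtain i j where "i \<in> {u n..u n + g (u n)}" "j \<in> {u n..u n + g (u n)}"
      "x j - x i > 6 / real m" by blast
    moreover from this obtain k where "k < m" "x i \<le> real k / real m" "real (Suc k) / real m \<le> x j"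
      using interval_contains_cell[of "x i" "x j" m] assms(2)[of i] assms(2)[of j] m by auto
    ultimately show ?thesis by blast
  qed
  then obtain h where h: "\<And>n. n \<le> 2 * m \<Longrightarrow> h n < m \<and> (\<exists>i\<in>{u n..u n + g (u n)}.
      \<exists>j\<in>{u n..u n + g (u n)}. x i \<le> real (h n) / real m \<and> real (Suc (h n)) / real m \<le> x j)"
    by metis
  obtain n1 n2 n3 where n: "n1 < n2" "n2 < n3" "n3 \<le> 2 * m" "h n1 = h n2" "h n2 = h n3"
    using pigeonhole_three[of m h] h by blast
  define a b where "a = real (h n1) / real m" and "b = real (Suc (h n1)) / real m"
  obtain i1 j1 where 1: "i1 \<in> {u n1..u n1 + g (u n1)}" "j1 \<in> {u n1..u n1 + g (u n1)}"
    "x i1 \<le> a" "b \<le> x j1"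
    using h[of n1] n unfolding a_def b_def by auto
  obtain i2 j2 where 2: "i2 \<in> {u n2..u n2 + g (u n2)}" "j2 \<in> {u n2..u n2 + g (u n2)}"
    "x i2 \<le> a" "b \<le> x j2"
    using h[of n2] n unfolding a_def b_def by auto
  obtain i3 j3 where 3: "i3 \<in> {u n3..u n3 + g (u n3)}" "j3 \<in> {u n3..u n3 + g (u n3)}"
    "x i3 \<le> a" "b \<le> x j3"
    using h[of n3] n unfolding a_def b_def by auto
  define L where "L = g (u n1)"
  define A where "A = KM_A \<epsilon> g (u n1)"
  have A: "0 < A" by (simp add: A_def KM_A_def)
  have w: "0 < \<omega> A"
    using assms(4) A by (auto simp: modulus_of_uniform_continuity_def)
  have "real L * (2 * A) \<le> 1 / (6 * real m)"
  proof (cases "L = 0")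
    \<comment> \<open>The maximum with 1 in the definition of $A$ takes effect only for $L = 0$.\<close>
    case False
    then have "1 \<le> 12 * m * L" using m by (simp add: Suc_le_eq)
    then have "1 \<le> 12 * real m * real L" by (metis of_nat_1 of_nat_le_iff of_nat_mult of_nat_numeral)
    then have "A = 1 / (12 * real m * real L)" by (simp add: A_def KM_A_def m_def L_def)
    then show ?thesis using m False by (simp add: field_simps)
  qed simp
  moreover have "b = a + 1 / real m" by (simp add: a_def b_def add_divide_distrib)
  moreover have "1 / (4 * real m) + 1 / (6 * real m) < 1 / real m"
    using m by (simp add: field_simps)
  \<comment> \<open>Entering the cell costs at most $1/(4m)$ and steps of length at most $2A$ at most $1/(6m)$ more,
    which is too little to cross it.\<close>
  ultimately have short: "a + c + real L * (2 * A) < b" using c by linarith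
  have step: "\<bar>x k - x (Suc k)\<bar> \<le> c" if "u n1 \<le> k" for k
  proof (rule rate)
    have "u 0 \<le> u n1" using gap[of 0 n1] by (cases "n1 = 0") auto
    then show "\<beta> c \<le> k" using that by (simp add: u_def c_def)
  qed fact
  have late_step: "\<bar>x k - x (Suc k)\<bar> \<le> min A (\<omega> A)" if "u (Suc n1) \<le> k" for k
  proof (rule rate)
    show "\<beta> (min A (\<omega> A)) \<le> k" using that by (simp add: u_def A_def KM_C_def)
  qed (use A w in simp)
  have cont: "\<bar>f (x k) - f (x l)\<bar> < A" if "\<bar>x k - x l\<bar> < \<omega> A" for k l
    using assms(2,4) A that unfolding modulus_of_uniform_continuity_def by blast
  have "u (Suc n1) \<le> u n2" using gap[of "Suc n1" n2] n by (cases "Suc n1 = n2") auto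
  moreover have "u n2 + g (u n2) < u n3" using gap n by blast
  ultimately show False
    using no_third_crossing[of x "\<lambda>k. f (x k)" "\<omega> A" A c "u n1" "u (Suc n1)" a L b i1 j1 i2 j2 i3 j3,
        OF assms(3) cont A less_imp_le[OF c(2)] step late_step short] 1 2 3
    by (auto simp: L_def)
qed

end
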